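(* Let $a\in\mathbb{R}$ and let $s$ be real with $0\le s\le 1$. Then for every $f\in E$ and every $x>a$, $$\lim_{s\to0^+}J^s(f)(x)=f(x),\qquad \lim_{s\to0^+}D^s(f)(x)=f(x).$$ In operator form, $$\lim_{s\to0^+}J^s=J^0=1_E,\qquad \lim_{s\to0^+}D^s=D^0=1_E.$$
   Context: $E$ denotes the set of integrable and derivable (differentiable) causal functions $f$ on the interval $I=\,]a,+\infty[$. Causal means that $f$ vanishes to the left of $a$; the value $f(a)$ may be zero or nonzero. Integrable means that $\int_a^x f(t)\,dt$ exists for every $x>a$ as a Lebesgue integral. $1_E$ is the identity operator on $E$, and $J^0=D^0=1_E$. For real $s>0$ the $s$-order integral operator is $$J^s(f)(x)=\frac{1}{\Gamma(s)}\int_a^x (x-y)^{s-1}f(y)\,dy,\qquad x>a,$$ where $\Gamma$ is Euler's gamma function. For $0<s<1$ the $s$-order derivative operator is $$D^s(f)(x)=\frac{d}{dx}J^{1-s}(f)(x)=\frac{1}{\Gamma(1-s)}\frac{d}{dx}\int_a^x (x-y)^{-s}f(y)\,dy,\qquad x>a,$$ and $D^1$ is the ordinary first derivative. Operator limits are understood pointwise, that is, for each $f\in E$ and each $x>a$. *)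

theory Defs
  imports "HOL-Analysis.Analysis"
begin

text \<open>
  Real-valued causal functions with origin \<open>a\<close>. The value at \<open>a\<close> itself is unconstrained.
  Such functions are continuous on the open half-line, so measurability is automatic there and
  integrability with respect to \<^const>\<open>lborel\<close> is Lebesgue integrability.
\<close>

definition causal_space :: "real \<Rightarrow> (real \<Rightarrow> real) set" where
  "causal_space a =
    {f. (\<forall>x<a. f x = 0) \<and>
        (\<forall>x>a. f differentiable at x) \<and>
        (\<forall>x>a. set_integrable lborel {a<..<x} f)}"

definition frac_integrand :: "real \<Rightarrow> (real \<Rightarrow> real) \<Rightarrow> real \<Rightarrow> real \<Rightarrow> real" where
  "frac_integrand s f x y = (x - y) powr (s - 1) * f y"

text \<open>Meaningful for \<open>s \<ge> 0\<close>.\<close>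

definition frac_int :: "real \<Rightarrow> real \<Rightarrow> (real \<Rightarrow> real) \<Rightarrow> real \<Rightarrow> real" where
  "frac_int a s f x =
    (if s = 0 then f x
     else 1 / Gamma s * (LBINT y:{a<..<x}. frac_integrand s f x y))"

text \<open>Meaningful for \<open>0 \<le> s \<le> 1\<close> and \<open>x > a\<close>. The first derivative needs its own case only
  syntactically: for \<open>s = 1\<close> the last line reads \<^term>\<open>deriv (frac_int a 0 f) x\<close>, which is the
  same value.\<close>

definition frac_deriv :: "real \<Rightarrow> real \<Rightarrow> (real \<Rightarrow> real) \<Rightarrow> real \<Rightarrow> real" where
  "frac_deriv a s f x =
    (if s = 0 then f x
     else if s = 1 then deriv f x
     else deriv (frac_int a (1 - s) f) x)"

text \<open>Pointwise limits of operators: for each function in the space and each point right of \<open>a\<close>.\<close>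

definition op_tendsto ::
  "real \<Rightarrow> (real \<Rightarrow> (real \<Rightarrow> real) \<Rightarrow> real \<Rightarrow> real) \<Rightarrow> ((real \<Rightarrow> real) \<Rightarrow> real \<Rightarrow> real)
    \<Rightarrow> real filter \<Rightarrow> bool" where
  "op_tendsto a T L F \<longleftrightarrow>
    (\<forall>f\<in>causal_space a. \<forall>x>a. ((\<lambda>s. T s f x) \<longlongrightarrow> L f x) F)"

end

theory Submission
  imports Defs
begin

text \<open>
  Differentiability of \<open>f\<close> at \<open>x\<close> gives \<open>\<bar>f y - f x\<bar> \<le> C * \<bar>y - x\<bar>\<close> near \<open>x\<close>, so the
  kernel integral of \<open>f - f x\<close> converges for exponents down to \<open>-2\<close> (exclusive), uniformly
  on compact ranges of exponents. Subtracting the constant \<open>f x\<close>, whose fractional integral is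
  explicit, one gets
  \<open>J\<^sup>s f x = (s * S s + f x * (x - a) powr s) / Gamma (1 + s)\<close> and
  \<open>D\<^sup>s f x = (- s * S (- s) + f x * (x - a) powr (- s)) / Gamma (1 - s)\<close> with
  \<open>S p = \<integral> (x - y) powr (p - 1) * (f y - f x) dy\<close> over \<open>{a<..<x}\<close>, and \<open>S\<close> is bounded near \<open>0\<close>.

  Since \<open>f'\<close> may fail to be integrable, the formula for \<open>D\<^sup>s\<close> is obtained without
  differentiating under a translated integral: in the difference quotient with step \<open>h\<close>
  the part \<open>y > x - 2 * \<bar>h\<bar>\<close> is \<open>O(\<bar>h\<bar> powr (1 - s))\<close>, while on \<open>y \<le> x - 2 * \<bar>h\<bar>\<close> the
  quotient of the kernel is at most a constant multiple of its derivative at \<open>x\<close>, so that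
  dominated convergence applies.
\<close>

section \<open>Integration against the kernel \<open>(x - y) powr r\<close>\<close>

lemma powr_kernel_integral:
  fixes c x r :: real
  assumes "c < x" "-1 < r"
  shows "set_integrable lborel {c<..<x} (\<lambda>y. (x - y) powr r)"
    and "(LBINT y:{c<..<x}. (x - y) powr r) = (x - c) powr (r + 1) / (r + 1)"
proof -
  let ?F = "\<lambda>y. - ((x - y) powr (r + 1) / (r + 1))"
  have DF: "DERIV ?F y :> (x - y) powr r" if "y < x" for y
    using that assms by (auto intro!: derivative_eq_intros)
  have "(?F \<longlongrightarrow> ?F c) (at_right c)"
    using assms by (intro tendsto_intros) auto
  then have A: "((?F \<circ> real_of_ereal) \<longlongrightarrow> ?F c) (at_right (ereal c))"
    by (simp only: ereal_tendsto_simps)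
  \<comment> \<open>For negative \<open>r\<close> the integrand is unbounded at \<open>x\<close>,
    but the antiderivative still has a limit there: its base tends to 0 through nonnegative values
    and its exponent \<open>r + 1\<close> is positive.\<close>
  have "eventually (\<lambda>y. 0 \<le> x - y) (at_left x)"
    by (auto simp: eventually_at_filter)
  then have "(?F \<longlongrightarrow> ?F x) (at_left x)"
    using assms by (intro tendsto_minus tendsto_divide tendsto_powr' tendsto_intros) auto
  then have B: "((?F \<circ> real_of_ereal) \<longlongrightarrow> ?F x) (at_left (ereal x))"
    by (simp only: ereal_tendsto_simps)
  have 1: "ereal c < ereal x" using assms by simp
  have 2: "DERIV ?F y :> (x - y) powr r" if "ereal c < ereal y" "ereal y < ereal x" for y
    using that DF by simp
  have 3: "isCont (\<lambda>y. (x - y) powr r) y" if "ereal c < ereal y" "ereal y < ereal x" for y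
    using that by (auto intro!: continuous_intros)
  have 4: "AE y in lborel. ereal c < ereal y \<longrightarrow> ereal y < ereal x \<longrightarrow> 0 \<le> (x - y) powr r"
    by simp
  note FTC = interval_integral_FTC_nonneg[OF 1 2 3 4 A B]
  from FTC(1) show "set_integrable lborel {c<..<x} (\<lambda>y. (x - y) powr r)"
    by simp
  from FTC(2) assms show "(LBINT y:{c<..<x}. (x - y) powr r) = (x - c) powr (r + 1) / (r + 1)"
    by (simp add: interval_lebesgue_integral_def)
qed

text \<open>A power is monotone in its base, with the direction given by the sign of
  \<open>r\<close>. Adding both endpoint values gives one bound for either sign.\<close>

lemma powr_le_powr_add_powr:
  fixes l u t r :: real
  assumes "0 < l" "l \<le> t" "t \<le> u"
  shows "t powr r \<le> l powr r + u powr r"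
proof (cases "0 \<le> r")
  case True
  then have "t powr r \<le> u powr r" using assms by (intro powr_mono2) auto
  then show ?thesis by (simp add: add_increasing)
next
  case False
  then have "t powr r \<le> l powr r" using assms by (intro powr_mono2') auto
  then show ?thesis by (simp add: add_increasing2)
qed

lemma set_borel_measurable_times:
  fixes w g :: "real \<Rightarrow> real"
  assumes "set_borel_measurable lborel S g" "w \<in> borel_measurable lborel"
  shows "set_borel_measurable lborel S (\<lambda>y. w y * g y)"
proof -
  have "(\<lambda>y. w y * (indicator S y *\<^sub>R g y)) \<in> borel_measurable lborel"
    using assms unfolding set_borel_measurable_def by (intro borel_measurable_times)
  also have "(\<lambda>y. w y * (indicator S y *\<^sub>R g y)) = (\<lambda>y. indicator S y *\<^sub>R (w y * g y))"
    by (auto simp: fun_eq_iff)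
  finally show ?thesis unfolding set_borel_measurable_def .
qed

text \<open>To the right of \<open>c\<close> the factor \<open>g\<close> is bounded and the kernel
  is integrable; to the left the kernel is bounded and \<open>g\<close> is integrable. The sum of
  the two resulting majorants works on the whole interval.\<close>

lemma set_integrable_powr_kernel:
  fixes a c x r M :: real and g :: "real \<Rightarrow> real"
  assumes "a < c" "c < x" "-1 < r"
    and g: "set_integrable lborel {a<..<x} g"
    and M: "\<And>y. c < y \<Longrightarrow> y < x \<Longrightarrow> \<bar>g y\<bar> \<le> M"
  shows "set_integrable lborel {a<..<x} (\<lambda>y. (x - y) powr r * g y)"
proof (rule set_integrable_bound)
  let ?K = "(x - c) powr r + (x - a) powr r"
  have "M \<ge> 0"
    using M[of "(c + x) / 2"] assms(1,2) by auto
  show "set_integrable lborel {a<..<x} (\<lambda>y. (x - y) powr r * M + ?K * \<bar>g y\<bar>)"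
    using assms by (intro set_integral_add set_integrable_mult_left set_integrable_mult_right
        set_integrable_abs powr_kernel_integral) auto
  show "set_borel_measurable lborel {a<..<x} (\<lambda>y. (x - y) powr r * g y)"
    using g unfolding set_integrable_def
    by (intro set_borel_measurable_times) (auto simp: set_borel_measurable_def)
  show "AE y in lborel. y \<in> {a<..<x} \<longrightarrow>
    norm ((x - y) powr r * g y) \<le> norm ((x - y) powr r * M + ?K * \<bar>g y\<bar>)"
  proof (intro AE_I2 impI)
    fix y assume y: "y \<in> {a<..<x}"
    have "(x - y) powr r * \<bar>g y\<bar> \<le> (x - y) powr r * M + ?K * \<bar>g y\<bar>"
    proof (cases "c < y")
      case True
      then have "(x - y) powr r * \<bar>g y\<bar> \<le> (x - y) powr r * M"
        using M y by (intro mult_left_mono) auto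
      then show ?thesis by (simp add: add_increasing2)
    next
      case False
      then have "(x - y) powr r * \<bar>g y\<bar> \<le> ?K * \<bar>g y\<bar>"
        using y assms by (intro mult_right_mono powr_le_powr_add_powr) auto
      then show ?thesis using \<open>M \<ge> 0\<close> by (simp add: add_increasing)
    qed
    then show "norm ((x - y) powr r * g y) \<le> norm ((x - y) powr r * M + ?K * \<bar>g y\<bar>)"
      by (simp add: abs_mult)
  qed
qed

lemma abs_powr_kernel_integral_le:
  fixes m w r M :: real and g :: "real \<Rightarrow> real"
  assumes "m < w" "-1 < r"
    and int: "set_integrable lborel {m<..<w} (\<lambda>y. (w - y) powr r * g y)"
    and M: "\<And>y. m < y \<Longrightarrow> y < w \<Longrightarrow> \<bar>g y\<bar> \<le> M"
  shows "\<bar>LBINT y:{m<..<w}. (w - y) powr r * g y\<bar> \<le> M * ((w - m) powr (r + 1) / (r + 1))"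
proof -
  have "\<bar>LBINT y:{m<..<w}. (w - y) powr r * g y\<bar> \<le> (LBINT y:{m<..<w}. \<bar>(w - y) powr r * g y\<bar>)"
    using set_integral_norm_bound[OF int] by simp
  also have "\<dots> \<le> (LBINT y:{m<..<w}. M * (w - y) powr r)"
    using assms
    by (intro set_integral_mono set_integrable_abs set_integrable_mult_right powr_kernel_integral)
       (auto simp: abs_mult mult.commute[of M] intro!: mult_left_mono)
  finally show ?thesis using powr_kernel_integral[OF assms(1,2)] by simp
qed

section \<open>Linear bounds at a point\<close>

lemma differentiable_imp_locally_lipschitz_at:
  fixes f :: "real \<Rightarrow> real"
  assumes "f differentiable at x"
  shows "\<exists>\<delta>>0. \<exists>C. \<forall>y. \<bar>y - x\<bar> < \<delta> \<longrightarrow> \<bar>f y - f x\<bar> \<le> C * \<bar>y - x\<bar>"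
proof -
  from assms obtain D where D: "(f has_real_derivative D) (at x)"
    by (auto simp: real_differentiable_def)
  then have "((\<lambda>y. (f y - f x) / (y - x)) \<longlongrightarrow> D) (at x)"
    by (simp add: has_field_derivative_iff)
  then have "eventually (\<lambda>y. dist ((f y - f x) / (y - x)) D < 1) (at x)"
    by (rule tendstoD) simp
  then obtain \<delta> where "0 < \<delta>"
    and \<delta>: "\<And>y. y \<noteq> x \<Longrightarrow> \<bar>y - x\<bar> < \<delta> \<Longrightarrow> \<bar>(f y - f x) / (y - x) - D\<bar> < 1"
    by (auto simp: eventually_at dist_real_def)
  have "\<bar>f y - f x\<bar> \<le> (\<bar>D\<bar> + 1) * \<bar>y - x\<bar>" if "\<bar>y - x\<bar> < \<delta>" for y
  proof (cases "y = x")
    case False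
    then have "\<bar>(f y - f x) / (y - x)\<bar> \<le> \<bar>D\<bar> + 1" using \<delta>[of y] that by linarith
    then show ?thesis using False by (simp add: abs_divide divide_simps)
  qed simp
  with \<open>0 < \<delta>\<close> show ?thesis by blast
qed

text \<open>Within \<open>\<delta>\<close> of \<open>x\<close> the linear bound makes the quotient
  at most \<open>C\<close>; farther away the denominator is at least \<open>\<delta>\<close>. Moving
  one factor \<open>x - y\<close> from the kernel to this quotient later lowers the admissible
  exponents by one.\<close>

lemma set_integrable_difference_quotient:
  fixes a x \<delta> C :: real and \<phi> :: "real \<Rightarrow> real"
  assumes "a < x" "0 < \<delta>"
    and int: "set_integrable lborel {a<..<x} \<phi>"
    and lip: "\<And>y. \<bar>y - x\<bar> < \<delta> \<Longrightarrow> \<bar>\<phi> y\<bar> \<le> C * \<bar>y - x\<bar>"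
  shows "set_integrable lborel {a<..<x} (\<lambda>y. \<phi> y / (x - y))"
proof (rule set_integrable_bound)
  \<comment> \<open>At any sample point other than \<open>x\<close> within \<open>\<delta>\<close>,
    the bound says that \<open>C\<close> times a positive number is nonnegative.\<close>
  have "0 \<le> C" using lip[of "x + \<delta> / 2"] \<open>0 < \<delta>\<close>
    by (auto intro: order_trans[OF abs_ge_zero] simp: zero_le_mult_iff)
       (smt (verit) half_gt_zero mult_neg_pos)
  have "set_integrable lborel {a<..<x} (\<lambda>_. C)"
    using \<open>a < x\<close> by (simp add: set_integrable_def integrable_real_indicator)
  then show "set_integrable lborel {a<..<x} (\<lambda>y. C + \<bar>\<phi> y\<bar> / \<delta>)"
    using int by (intro set_integral_add set_integrable_divide set_integrable_abs) auto
  have "set_borel_measurable lborel {a<..<x} (\<lambda>y. inverse (x - y) * \<phi> y)"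
    using int unfolding set_integrable_def
    by (intro set_borel_measurable_times) (auto simp: set_borel_measurable_def)
  then show "set_borel_measurable lborel {a<..<x} (\<lambda>y. \<phi> y / (x - y))"
    by (simp add: field_simps)
  show "AE y in lborel. y \<in> {a<..<x} \<longrightarrow> norm (\<phi> y / (x - y)) \<le> norm (C + \<bar>\<phi> y\<bar> / \<delta>)"
  proof (intro AE_I2 impI)
    fix y assume y: "y \<in> {a<..<x}"
    have "\<bar>\<phi> y\<bar> / (x - y) \<le> C + \<bar>\<phi> y\<bar> / \<delta>"
    proof (cases "x - y < \<delta>")
      case True
      then have "\<bar>\<phi> y\<bar> / (x - y) \<le> C" using lip[of y] y by (simp add: divide_simps)
      then show ?thesis using \<open>0 < \<delta>\<close> by (simp add: add_increasing2)
    next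
      case False
      then have "\<bar>\<phi> y\<bar> / (x - y) \<le> \<bar>\<phi> y\<bar> / \<delta>"
        using \<open>0 < \<delta>\<close> by (intro divide_left_mono) auto
      then show ?thesis using \<open>0 \<le> C\<close> by simp
    qed
    then show "norm (\<phi> y / (x - y)) \<le> norm (C + \<bar>\<phi> y\<bar> / \<delta>)"
      using y by (simp add: abs_divide)
  qed
qed

section \<open>Differentiation of the kernel integral\<close>

text \<open>The condition \<open>2 * |h| <= u\<close> keeps \<open>u + h\<close> in
  \<open>{u / 2..}\<close>, where the derivative of \<open>t powr (- s)\<close> is largest in
  absolute value at \<open>u / 2\<close>. The mean value inequality then bounds the quotient
  independently of \<open>h\<close>.\<close>

lemma powr_difference_quotient_bound:
  fixes u h s :: real
  assumes "0 < s" "h \<noteq> 0" "2 * \<bar>h\<bar> \<le> u"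
  shows "\<bar>((u + h) powr (- s) - u powr (- s)) / h\<bar> \<le> s * (u / 2) powr (- s - 1)"
proof -
  have "norm ((u + h) powr (- s) - u powr (- s)) \<le> (s * (u / 2) powr (- s - 1)) * norm (u + h - u)"
  proof (rule field_differentiable_bound[where S = "{u / 2..}"])
    fix t assume "t \<in> {u / 2..}"
    then have t: "u / 2 \<le> t" "0 < t" using assms by auto
    show "((\<lambda>t. t powr (- s)) has_field_derivative - s * t powr (- s - 1)) (at t within {u / 2..})"
      using t by (auto intro!: derivative_eq_intros)
    show "norm (- s * t powr (- s - 1)) \<le> s * (u / 2) powr (- s - 1)"
      using t assms by (auto simp: abs_mult intro!: mult_left_mono powr_mono2')
  qed (use assms in auto)
  then show ?thesis using assms by (simp add: abs_divide divide_simps)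
qed

lemma set_borel_measurable_indicator:
  fixes g :: "real \<Rightarrow> real"
  assumes "set_borel_measurable lborel S g" "T \<subseteq> S" "T \<in> sets lborel"
  shows "(\<lambda>y. indicator T y * g y) \<in> borel_measurable lborel"
proof -
  have "(\<lambda>y. indicator T y * (indicator S y *\<^sub>R g y)) \<in> borel_measurable lborel"
    using assms unfolding set_borel_measurable_def by (intro borel_measurable_times) auto
  also have "(\<lambda>y. indicator T y * (indicator S y *\<^sub>R g y)) = (\<lambda>y. indicator T y * g y)"
    using assms by (auto simp: fun_eq_iff indicator_def)
  finally show ?thesis .
qed

lemma powr_difference_quotient_integral_tendsto:
  fixes a x s :: real and \<phi> :: "real \<Rightarrow> real"
  assumes "a < x" "0 < s"
    and \<phi>: "set_integrable lborel {a<..<x} \<phi>"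
    and int: "set_integrable lborel {a<..<x} (\<lambda>y. (x - y) powr (- s - 1) * \<phi> y)"
  shows "((\<lambda>h. LBINT y:{a<..x - 2 * \<bar>h\<bar>}.
            ((x + h - y) powr (- s) - (x - y) powr (- s)) / h * \<phi> y)
          \<longlongrightarrow> - s * (LBINT y:{a<..<x}. (x - y) powr (- s - 1) * \<phi> y)) (at 0)"
proof -
  let ?Q = "\<lambda>h y. ((x + h - y) powr (- s) - (x - y) powr (- s)) / h"
  \<comment> \<open>The factor \<open>2 powr (s + 1)\<close> comes from evaluating the derivative
    bound at \<open>(x - y) / 2\<close> instead of \<open>x - y\<close>.\<close>
  let ?w = "\<lambda>y. s * 2 powr (s + 1) * (indicator {a<..<x} y *\<^sub>R \<bar>(x - y) powr (- s - 1) * \<phi> y\<bar>)"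
  let ?g = "\<lambda>y. indicator {a<..<x} y *\<^sub>R (- s * (x - y) powr (- s - 1) * \<phi> y)"
  let ?f = "\<lambda>h y. indicator {a<..x - 2 * \<bar>h\<bar>} y *\<^sub>R (?Q h y * \<phi> y)"
  have meas: "set_borel_measurable lborel {a<..<x} \<phi>"
    using \<phi> unfolding set_integrable_def by (auto simp: set_borel_measurable_def)
  have "((\<lambda>h. integral\<^sup>L lborel (?f h)) \<longlongrightarrow> integral\<^sup>L lborel ?g) (at 0)"
    unfolding tendsto_at_iff_sequentially
  proof (intro allI impI)
    fix X :: "nat \<Rightarrow> real"
    assume "\<forall>i. X i \<in> UNIV - {0}" and X0: "X \<longlonglongrightarrow> 0"
    then have X: "X i \<noteq> 0" for i by auto
    have "(\<lambda>i. integral\<^sup>L lborel (?f (X i))) \<longlonglongrightarrow> integral\<^sup>L lborel ?g"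
    proof (rule integral_dominated_convergence[where w = ?w])
      have "set_borel_measurable lborel {a<..<x} (\<lambda>y. (- s * (x - y) powr (- s - 1)) * \<phi> y)"
        using meas by (intro set_borel_measurable_times) auto
      then show "?g \<in> borel_measurable lborel"
        by (simp add: set_borel_measurable_def)
      show "?f (X i) \<in> borel_measurable lborel" for i
      proof -
        have "set_borel_measurable lborel {a<..<x} (\<lambda>y. ?Q (X i) y * \<phi> y)"
          using meas by (intro set_borel_measurable_times) auto
        then have "(\<lambda>y. indicator {a<..x - 2 * \<bar>X i\<bar>} y * (?Q (X i) y * \<phi> y)) \<in> borel_measurable lborel"
          using X[of i] by (intro set_borel_measurable_indicator) auto
        then show ?thesis by simp
      qed
      show "integrable lborel ?w"
        using set_integrable_abs[OF int] unfolding set_integrable_def by (intro integrable_mult_right)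
      show "AE y in lborel. norm (?f (X i) y) \<le> ?w y" for i
      proof (rule AE_I2)
        fix y
        show "norm (?f (X i) y) \<le> ?w y"
        proof (cases "y \<in> {a<..x - 2 * \<bar>X i\<bar>}")
          case True
          then have y: "y \<in> {a<..<x}" using X[of i] by auto
          have "\<bar>?Q (X i) y\<bar> \<le> s * ((x - y) / 2) powr (- s - 1)"
            using powr_difference_quotient_bound[of s "X i" "x - y"] X[of i] True assms
            by (simp add: algebra_simps)
          also have "\<dots> = s * 2 powr (s + 1) * (x - y) powr (- s - 1)"
            using y by (simp add: powr_divide powr_diff powr_add powr_minus field_simps)
          finally have "\<bar>?Q (X i) y\<bar> * \<bar>\<phi> y\<bar> \<le> s * 2 powr (s + 1) * (x - y) powr (- s - 1) * \<bar>\<phi> y\<bar>"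
            by (rule mult_right_mono) simp
          then show ?thesis using True y by (simp add: abs_mult mult_ac)
        qed (use \<open>0 < s\<close> in \<open>simp add: indicator_def\<close>)
      qed
      show "AE y in lborel. (\<lambda>i. ?f (X i) y) \<longlonglongrightarrow> ?g y"
      proof (rule AE_I2)
        fix y
        show "(\<lambda>i. ?f (X i) y) \<longlonglongrightarrow> ?g y"
        proof (cases "y \<in> {a<..<x}")
          case True
          have "((\<lambda>t. (t - y) powr (- s)) has_real_derivative - s * (x - y) powr (- s - 1)) (at x)"
            using True by (auto intro!: derivative_eq_intros)
          then have "((\<lambda>h. ?Q h y) \<longlongrightarrow> - s * (x - y) powr (- s - 1)) (at 0)"
            by (simp add: DERIV_def)
          then have "(\<lambda>i. ?Q (X i) y) \<longlonglongrightarrow> - s * (x - y) powr (- s - 1)"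
            using X X0 unfolding tendsto_at_iff_sequentially by (auto simp: o_def)
          then have "(\<lambda>i. ?Q (X i) y * \<phi> y) \<longlonglongrightarrow> - s * (x - y) powr (- s - 1) * \<phi> y"
            by (rule tendsto_mult_right)
          then have lim: "(\<lambda>i. ?Q (X i) y * \<phi> y) \<longlonglongrightarrow> ?g y"
            using True by simp
          \<comment> \<open>A fixed \<open>y < x\<close> eventually lies left of the moving cut
            \<open>x - 2 * |X i|\<close>, so the truncation does not affect the pointwise
            limit.\<close>
          have "eventually (\<lambda>i. \<bar>X i\<bar> < (x - y) / 2) sequentially"
            using tendstoD[OF X0, of "(x - y) / 2"] True by (simp add: dist_real_def)
          then have "eventually (\<lambda>i. ?Q (X i) y * \<phi> y = ?f (X i) y) sequentially"
            by eventually_elim (use True in \<open>auto simp: indicator_def\<close>)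
          with lim show ?thesis by (rule Lim_transform_eventually)
        next
          case False
          then have "indicator {a<..x - 2 * \<bar>X i\<bar>} y = (0::real)" for i
            using X[of i] by (auto simp: indicator_def)
          then have "(\<lambda>i. ?f (X i) y) = (\<lambda>_. 0)" by (simp only: scaleR_zero_left)
          then show ?thesis using False by simp
        qed
      qed
    qed
    then show "((\<lambda>h. integral\<^sup>L lborel (?f h)) \<circ> X) \<longlonglongrightarrow> integral\<^sup>L lborel ?g"
      by (simp add: o_def)
  qed
  then show ?thesis
    by (simp add: set_lebesgue_integral_def mult_ac flip: integral_mult_right_zero integral_minus)
qed

text \<open>The upper limit and the kernel both vary with \<open>z\<close>. Cutting at
  \<open>x - 2 * |h|\<close> leaves a common head, whose quotient \<open>?A\<close> converges to the
  claimed derivative, and two short tails, whose contribution \<open>?B\<close> vanishes because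
  \<open>\<phi>\<close> is small near \<open>x\<close>.\<close>

lemma powr_kernel_integral_has_derivative:
  fixes a x s \<delta> C :: real and \<phi> :: "real \<Rightarrow> real"
  assumes "a < x" "0 < s" "s < 1" "0 < \<delta>"
    and int: "\<And>z. a < z \<Longrightarrow> set_integrable lborel {a<..<z} (\<lambda>y. (z - y) powr (- s) * \<phi> y)"
    and \<phi>: "set_integrable lborel {a<..<x} \<phi>"
    and intD: "set_integrable lborel {a<..<x} (\<lambda>y. (x - y) powr (- s - 1) * \<phi> y)"
    and lip: "\<And>y. \<bar>y - x\<bar> < \<delta> \<Longrightarrow> \<bar>\<phi> y\<bar> \<le> C * \<bar>y - x\<bar>"
  shows "((\<lambda>z. LBINT y:{a<..<z}. (z - y) powr (- s) * \<phi> y) has_real_derivative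
          - s * (LBINT y:{a<..<x}. (x - y) powr (- s - 1) * \<phi> y)) (at x)"
proof -
  let ?I = "\<lambda>z. LBINT y:{a<..<z}. (z - y) powr (- s) * \<phi> y"
  let ?L = "- s * (LBINT y:{a<..<x}. (x - y) powr (- s - 1) * \<phi> y)"
  let ?A = "\<lambda>h. LBINT y:{a<..x - 2 * \<bar>h\<bar>}.
            ((x + h - y) powr (- s) - (x - y) powr (- s)) / h * \<phi> y"
  let ?B = "\<lambda>h. (?I (x + h) - ?I x) / h - ?A h"
  have A: "(?A \<longlongrightarrow> ?L) (at 0)"
    using assms by (intro powr_difference_quotient_integral_tendsto)
  have "0 \<le> C" using lip[of "x + \<delta> / 2"] \<open>0 < \<delta>\<close>
    by (auto intro: order_trans[OF abs_ge_zero] simp: zero_le_mult_iff)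
       (smt (verit) half_gt_zero mult_neg_pos)
  \<comment> \<open>On a tail \<open>|\<phi>|\<close> is at most \<open>2 * C * |h|\<close>, and a
    tail is at most \<open>3 * |h|\<close> long. The two tails together give the factor 4, and
    division by \<open>h\<close> removes one power of \<open>|h|\<close>.\<close>
  have B: "\<bar>?B h\<bar> \<le> 4 * C * ((3 * \<bar>h\<bar>) powr (1 - s) / (1 - s))"
    if h: "h \<noteq> 0" "2 * \<bar>h\<bar> < x - a" "2 * \<bar>h\<bar> < \<delta>" for h
  proof -
    define m where "m = x - 2 * \<bar>h\<bar>"
    \<comment> \<open>The cut lies left of both \<open>x\<close> and \<open>x + h\<close> whatever
      the sign of \<open>h\<close>.\<close>
    have m: "a < m" "m < x" "m < x + h" using h by (auto simp: m_def)
    let ?R = "\<lambda>w. LBINT y:{m<..<w}. (w - y) powr (- s) * \<phi> y"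
    have head: "set_integrable lborel {a<..m} (\<lambda>y. (w - y) powr (- s) * \<phi> y)"
      and tail: "set_integrable lborel {m<..<w} (\<lambda>y. (w - y) powr (- s) * \<phi> y)"
      and split: "?I w = (LBINT y:{a<..m}. (w - y) powr (- s) * \<phi> y) + ?R w"
      if w: "m < w" for w
    proof -
      have U: "{a<..<w} = {a<..m} \<union> {m<..<w}" using w m by auto
      have "a < w" using w m by simp
      note i = int[OF this]
      show 1: "set_integrable lborel {a<..m} (\<lambda>y. (w - y) powr (- s) * \<phi> y)"
        by (rule set_integrable_subset[OF i]) (use U in auto)
      show 2: "set_integrable lborel {m<..<w} (\<lambda>y. (w - y) powr (- s) * \<phi> y)"
        by (rule set_integrable_subset[OF i]) (use U in auto)
      show "?I w = (LBINT y:{a<..m}. (w - y) powr (- s) * \<phi> y) + ?R w"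
        unfolding U by (rule set_integral_Un[OF _ 1 2]) auto
    qed
    have R: "\<bar>?R w\<bar> \<le> 2 * C * \<bar>h\<bar> * ((3 * \<bar>h\<bar>) powr (1 - s) / (1 - s))"
      if w: "m < w" "w \<le> x + \<bar>h\<bar>" for w
    proof -
      have "\<bar>\<phi> y\<bar> \<le> 2 * C * \<bar>h\<bar>" if "m < y" "y < w" for y
      proof -
        have y: "\<bar>y - x\<bar> \<le> 2 * \<bar>h\<bar>" using that w by (auto simp: m_def)
        then have "\<bar>\<phi> y\<bar> \<le> C * \<bar>y - x\<bar>" using h by (intro lip) auto
        also have "\<dots> \<le> C * (2 * \<bar>h\<bar>)" using y \<open>0 \<le> C\<close> by (rule mult_left_mono)
        finally show ?thesis by simp
      qed
      then have "\<bar>?R w\<bar> \<le> 2 * C * \<bar>h\<bar> * ((w - m) powr (- s + 1) / (- s + 1))"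
        using assms w by (intro abs_powr_kernel_integral_le tail) auto
      also have "\<dots> \<le> 2 * C * \<bar>h\<bar> * ((3 * \<bar>h\<bar>) powr (1 - s) / (1 - s))"
        using assms w \<open>0 \<le> C\<close>
        by (auto intro!: mult_left_mono divide_right_mono powr_mono2 simp: m_def)
      finally show ?thesis .
    qed
    \<comment> \<open>The heads of the integrals at \<open>x + h\<close> and \<open>x\<close> have
      the same domain and combine to \<open>?A h\<close>, so only the tails remain in
      \<open>?B h\<close>.\<close>
    have "?A h = ((LBINT y:{a<..m}. (x + h - y) powr (- s) * \<phi> y)
        - (LBINT y:{a<..m}. (x - y) powr (- s) * \<phi> y)) / h"
      unfolding set_integral_diff(2)[OF head[OF m(3)] head[OF m(2)], symmetric]
      by (simp add: m_def left_diff_distrib flip: set_integral_divide_zero)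
    then have "?B h = (?R (x + h) - ?R x) / h"
      unfolding split[OF m(2)] split[OF m(3)] by (simp add: diff_divide_distrib add_divide_distrib)
    moreover have "\<bar>?R (x + h) - ?R x\<bar> \<le> 2 * (2 * C * \<bar>h\<bar> * ((3 * \<bar>h\<bar>) powr (1 - s) / (1 - s)))"
      using R[OF m(2)] R[OF m(3)] by linarith
    ultimately have "\<bar>?B h\<bar> \<le> 2 * (2 * C * \<bar>h\<bar> * ((3 * \<bar>h\<bar>) powr (1 - s) / (1 - s))) / \<bar>h\<bar>"
      by (simp only: abs_divide divide_right_mono abs_ge_zero)
    then show ?thesis using h by simp
  qed
  have "((\<lambda>h. 4 * C * ((3 * \<bar>h\<bar>) powr (1 - s) / (1 - s))) \<longlongrightarrow>
          4 * C * ((3 * \<bar>0\<bar>) powr (1 - s) / (1 - s))) (at 0)"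
    using \<open>s < 1\<close> by (intro tendsto_intros) auto
  then have "((\<lambda>h. 4 * C * ((3 * \<bar>h\<bar>) powr (1 - s) / (1 - s))) \<longlongrightarrow> 0) (at 0)"
    by simp
  moreover have "eventually (\<lambda>h. norm (?B h) \<le> 4 * C * ((3 * \<bar>h\<bar>) powr (1 - s) / (1 - s))) (at 0)"
    unfolding eventually_at
    by (rule exI[of _ "min (x - a) \<delta> / 2"]) (use assms B in \<open>auto simp: dist_real_def\<close>)
  ultimately have "(?B \<longlongrightarrow> 0) (at 0)"
    by (rule Lim_null_comparison[rotated])
  from tendsto_add[OF A this] show ?thesis
    by (simp add: DERIV_def)
qed

section \<open>Limits as the order tends to 0 from the right\<close>

lemma Gamma_reciprocal_tendsto:
  "((\<lambda>s::real. 1 / Gamma (1 + s)) \<longlongrightarrow> 1) (at_right 0)"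
  "((\<lambda>s::real. 1 / Gamma (1 - s)) \<longlongrightarrow> 1) (at_right 0)"
proof -
  have "((\<lambda>s::real. 1 / Gamma (1 + s)) \<longlongrightarrow> 1 / Gamma (1 + 0)) (at_right 0)"
    "((\<lambda>s::real. 1 / Gamma (1 - s)) \<longlongrightarrow> 1 / Gamma (1 - 0)) (at_right 0)"
    by (intro tendsto_intros; simp)+
  then show "((\<lambda>s::real. 1 / Gamma (1 + s)) \<longlongrightarrow> 1) (at_right 0)"
    "((\<lambda>s::real. 1 / Gamma (1 - s)) \<longlongrightarrow> 1) (at_right 0)"
    by simp_all
qed

lemma mult_bounded_tendsto_0:
  fixes g :: "real \<Rightarrow> real"
  assumes "eventually (\<lambda>s. \<bar>g s\<bar> \<le> M) (at_right 0)"
  shows "((\<lambda>s. s * g s) \<longlongrightarrow> 0) (at_right 0)"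
proof (rule Lim_null_comparison)
  show "eventually (\<lambda>s. norm (s * g s) \<le> \<bar>s\<bar> * M) (at_right 0)"
    using assms by eventually_elim (simp add: abs_mult mult_left_mono)
  have "((\<lambda>s::real. \<bar>s\<bar> * M) \<longlongrightarrow> \<bar>0\<bar> * M) (at_right 0)"
    by (intro tendsto_intros)
  then show "((\<lambda>s::real. \<bar>s\<bar> * M) \<longlongrightarrow> 0) (at_right 0)" by simp
qed

section \<open>Fractional integral and derivative near a fixed point \<open>x\<close>\<close>

context
  fixes a x \<delta> C :: real and f :: "real \<Rightarrow> real"
  assumes f: "f \<in> causal_space a" and x: "a < x"
    and \<delta>: "0 < \<delta>" "\<And>y. \<bar>y - x\<bar> < \<delta> \<Longrightarrow> \<bar>f y - f x\<bar> \<le> C * \<bar>y - x\<bar>"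
begin

lemma causal_space_set_integrable: "a < z \<Longrightarrow> set_integrable lborel {a<..<z} f"
  using f by (auto simp: causal_space_def)

lemma causal_space_set_integrable_diff:
  assumes "a < z"
  shows "set_integrable lborel {a<..<z} (\<lambda>y. f y - f x)"
proof -
  have "set_integrable lborel {a<..<z} (\<lambda>_. f x)"
    using assms by (simp add: set_integrable_def integrable_real_indicator)
  with causal_space_set_integrable[OF assms] show ?thesis
    by (rule set_integral_diff)
qed

text \<open>Differentiability at \<open>z\<close> itself gives continuity up to the right endpoint,
  so compactness bounds \<open>f\<close> there. Near \<open>a\<close> the function may be unbounded,
  hence the cut at the midpoint.\<close>

lemma causal_space_bounded_left:
  assumes "a < z"
  obtains c M where "a < c" "c < z" "\<And>y. c < y \<Longrightarrow> y < z \<Longrightarrow> \<bar>f y\<bar> \<le> M"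
proof -
  let ?c = "(a + z) / 2"
  have "continuous_on {?c..z} f"
    using f assms
    by (intro continuous_at_imp_continuous_on ballI differentiable_imp_continuous_within)
       (auto simp: causal_space_def)
  then have "bounded (f ` {?c..z})"
    by (intro compact_imp_bounded compact_continuous_image) auto
  then obtain M where "\<forall>y\<in>{?c..z}. \<bar>f y\<bar> \<le> M"
    by (auto simp: bounded_iff)
  then show thesis using assms by (intro that[of ?c M]) auto
qed

lemma set_integrable_kernel:
  assumes "a < z" "-1 < r"
  shows "set_integrable lborel {a<..<z} (\<lambda>y. (z - y) powr r * f y)"
    and "set_integrable lborel {a<..<z} (\<lambda>y. (z - y) powr r * (f y - f x))"
proof -
  obtain c M where c: "a < c" "c < z" and M: "\<And>y. c < y \<Longrightarrow> y < z \<Longrightarrow> \<bar>f y\<bar> \<le> M"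
    using causal_space_bounded_left[OF \<open>a < z\<close>] by blast
  show "set_integrable lborel {a<..<z} (\<lambda>y. (z - y) powr r * f y)"
    using set_integrable_powr_kernel[OF c \<open>-1 < r\<close> causal_space_set_integrable[OF \<open>a < z\<close>] M] .
  have "\<bar>f y - f x\<bar> \<le> M + \<bar>f x\<bar>" if "c < y" "y < z" for y
    using M[OF that] by linarith
  then show "set_integrable lborel {a<..<z} (\<lambda>y. (z - y) powr r * (f y - f x))"
    using set_integrable_powr_kernel[OF c \<open>-1 < r\<close> causal_space_set_integrable_diff[OF \<open>a < z\<close>]]
    by blast
qed

lemma set_integrable_kernel_quotient:
  assumes "-1 < r"
  shows "set_integrable lborel {a<..<x} (\<lambda>y. (x - y) powr r * ((f y - f x) / (x - y)))"
proof -
  \<comment> \<open>The first entry keeps \<open>c\<close> right of \<open>a\<close>, and the second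
    keeps the points between \<open>c\<close> and \<open>x\<close> within \<open>\<delta>\<close> of
    \<open>x\<close>.\<close>
  define c where "c = max ((a + x) / 2) (x - \<delta> / 2)"
  have c: "a < c" "c < x" using x \<delta>(1) by (auto simp: c_def less_max_iff_disj)
  have q: "set_integrable lborel {a<..<x} (\<lambda>y. (f y - f x) / (x - y))"
    using set_integrable_difference_quotient[OF x \<delta>(1) causal_space_set_integrable_diff[OF x] \<delta>(2)] .
  have "\<bar>(f y - f x) / (x - y)\<bar> \<le> C" if "c < y" "y < x" for y
    using \<delta>(2)[of y] \<delta>(1) that by (simp add: c_def abs_divide divide_simps)
  then show ?thesis
    using set_integrable_powr_kernel[OF c assms q] by blast
qed

text \<open>One factor \<open>1 / (x - y)\<close> of the kernel is absorbed into the bounded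
  difference quotient, which brings exponents between -2 and -1 within reach.\<close>

lemma set_integrable_singular_kernel:
  assumes "-1 < r"
  shows "set_integrable lborel {a<..<x} (\<lambda>y. (x - y) powr (r - 1) * (f y - f x))"
proof -
  have "set_integrable lborel {a<..<x} (\<lambda>y. (x - y) powr (r - 1) * (f y - f x)) \<longleftrightarrow>
        set_integrable lborel {a<..<x} (\<lambda>y. (x - y) powr r * ((f y - f x) / (x - y)))"
    by (rule set_integrable_cong) (auto simp: powr_diff)
  with set_integrable_kernel_quotient[OF assms] show ?thesis by simp
qed

text \<open>For \<open>t >= 1\<close> the power \<open>t powr (p - 1)\<close> is largest at
  \<open>p = 1\<close>, for \<open>t < 1\<close> at the smallest \<open>p\<close>. The sum of the
  two extreme integrands therefore dominates uniformly in \<open>p\<close>.\<close>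

lemma singular_kernel_integral_bounded:
  assumes "-1 < r"
  obtains M where "\<And>p. r \<le> p \<Longrightarrow> p \<le> 1 \<Longrightarrow>
    \<bar>LBINT y:{a<..<x}. (x - y) powr (p - 1) * (f y - f x)\<bar> \<le> M"
proof -
  let ?g = "\<lambda>p y. (x - y) powr (p - 1) * (f y - f x)"
  let ?M = "LBINT y:{a<..<x}. \<bar>?g r y\<bar> + \<bar>?g 1 y\<bar>"
  note int = set_integrable_singular_kernel
  have "\<bar>LBINT y:{a<..<x}. ?g p y\<bar> \<le> ?M" if p: "r \<le> p" "p \<le> 1" for p
  proof -
    have "-1 < p" using p assms by simp
    have "\<bar>LBINT y:{a<..<x}. ?g p y\<bar> \<le> (LBINT y:{a<..<x}. \<bar>?g p y\<bar>)"
      using set_integral_norm_bound[OF int[OF \<open>-1 < p\<close>]] by simp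
    also have "\<dots> \<le> ?M"
    proof (intro set_integral_mono set_integrable_abs set_integral_add int)
      fix y assume y: "y \<in> {a<..<x}"
      have "(x - y) powr (p - 1) \<le> (x - y) powr (r - 1) + (x - y) powr (1 - 1)"
      proof (cases "1 \<le> x - y")
        case True
        then have "(x - y) powr (p - 1) \<le> (x - y) powr (1 - 1)"
          using p by (intro powr_mono) auto
        then show ?thesis by (simp add: add_increasing)
      next
        case False
        then have "(x - y) powr (p - 1) \<le> (x - y) powr (r - 1)"
          using p y by (intro powr_mono') auto
        then show ?thesis by (simp add: add_increasing2)
      qed
      then have "(x - y) powr (p - 1) * \<bar>f y - f x\<bar> \<le>
          ((x - y) powr (r - 1) + (x - y) powr (1 - 1)) * \<bar>f y - f x\<bar>"
        by (rule mult_right_mono) simp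
      then show "\<bar>?g p y\<bar> \<le> \<bar>?g r y\<bar> + \<bar>?g 1 y\<bar>"
        by (simp add: abs_mult distrib_right)
    qed (use assms \<open>-1 < p\<close> in auto)
    finally show ?thesis .
  qed
  then show thesis by (rule that)
qed

lemma kernel_integral_split:
  assumes "a < z" "-1 < r"
  shows "(LBINT y:{a<..<z}. (z - y) powr r * f y) =
    (LBINT y:{a<..<z}. (z - y) powr r * (f y - f x)) + f x * ((z - a) powr (r + 1) / (r + 1))"
proof -
  note 1 = set_integrable_kernel(2)[OF assms]
  note 2 = set_integrable_mult_right[OF powr_kernel_integral(1)[OF assms], of "f x"]
  show ?thesis
    unfolding powr_kernel_integral(2)[OF assms, symmetric]
      set_integral_mult_right[symmetric] set_integral_add(2)[OF 1 2, symmetric]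
    by (simp add: algebra_simps)
qed

lemma set_integrable_frac_integrand:
  assumes "0 < s"
  shows "set_integrable lborel {a<..<x} (frac_integrand s f x)"
  using set_integrable_kernel(1)[OF x, of "s - 1"] assms by (simp add: frac_integrand_def[abs_def])

lemma frac_int_eq:
  assumes "0 < s" "a < z"
  shows "frac_int a s f z =
    1 / Gamma s * ((LBINT y:{a<..<z}. (z - y) powr (s - 1) * (f y - f x)) +
      f x * ((z - a) powr s / s))"
  using kernel_integral_split[OF \<open>a < z\<close>, of "s - 1"] assms
  by (simp add: frac_int_def frac_integrand_def[abs_def])

text \<open>Since \<open>1 / Gamma s = s / Gamma (1 + s)\<close>, the factor \<open>s\<close> sends
  the bounded part to 0 and cancels the \<open>1 / s\<close> in the integral of the constant
  \<open>f x\<close>.\<close>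

lemma frac_int_tendsto: "((\<lambda>s. frac_int a s f x) \<longlongrightarrow> f x) (at_right 0)"
proof -
  let ?S = "\<lambda>s. LBINT y:{a<..<x}. (x - y) powr (s - 1) * (f y - f x)"
  obtain M where M: "\<And>p. 0 \<le> p \<Longrightarrow> p \<le> 1 \<Longrightarrow> \<bar>?S p\<bar> \<le> M"
    using singular_kernel_integral_bounded[of 0] by auto
  have "eventually (\<lambda>s. \<bar>?S s\<bar> \<le> M) (at_right 0)"
    using eventually_at_right_real[of 0 1] by (auto elim!: eventually_mono intro: M)
  then have "((\<lambda>s. s * ?S s) \<longlongrightarrow> 0) (at_right 0)"
    by (rule mult_bounded_tendsto_0)
  moreover have "((\<lambda>s. f x * (x - a) powr s) \<longlongrightarrow> f x * (x - a) powr 0) (at_right 0)"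
    using x by (intro tendsto_intros) auto
  ultimately have "((\<lambda>s. 1 / Gamma (1 + s) * (s * ?S s + f x * (x - a) powr s)) \<longlongrightarrow>
      1 * (0 + f x * (x - a) powr 0)) (at_right 0)"
    by (intro tendsto_mult[OF Gamma_reciprocal_tendsto(1)] tendsto_add)
  then have "((\<lambda>s. 1 / Gamma (1 + s) * (s * ?S s + f x * (x - a) powr s)) \<longlongrightarrow> f x) (at_right 0)"
    using x by simp
  moreover have "eventually (\<lambda>s. 1 / Gamma (1 + s) * (s * ?S s + f x * (x - a) powr s)
      = frac_int a s f x) (at_right 0)"
  proof (rule eventually_at_rightI[of 0 1])
    fix s :: real assume "s \<in> {0<..<1}"
    then have "0 < s" by simp
    then have "s \<notin> \<int>\<^sub>\<le>\<^sub>0" by auto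
    then have "Gamma (1 + s) = s * Gamma s" using Gamma_plus1[of s] by (simp add: add.commute)
    then show "1 / Gamma (1 + s) * (s * ?S s + f x * (x - a) powr s) = frac_int a s f x"
      using \<open>0 < s\<close> Gamma_real_pos[OF \<open>0 < s\<close>]
      unfolding frac_int_eq[OF \<open>0 < s\<close> x] by (simp add: field_simps)
  qed simp
  ultimately show ?thesis by (rule Lim_transform_eventually)
qed

text \<open>The subtracted constant stays \<open>f x\<close> while the upper limit \<open>z\<close>
  moves. Hence \<open>f y - f x\<close> vanishes linearly exactly at the point of differentiation,
  and the constant part is an explicit power of \<open>z - a\<close>.\<close>

lemma frac_int_has_derivative:
  assumes s: "0 < s" "s < 1"
  shows "(frac_int a (1 - s) f has_real_derivative
    1 / Gamma (1 - s) * (- s * (LBINT y:{a<..<x}. (x - y) powr (- s - 1) * (f y - f x)) +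
      f x * (x - a) powr (- s))) (at x)"
proof -
  let ?I = "\<lambda>z. LBINT y:{a<..<z}. (z - y) powr (- s) * (f y - f x)"
  have I: "(?I has_real_derivative - s * (LBINT y:{a<..<x}. (x - y) powr (- s - 1) * (f y - f x))) (at x)"
    using s by (intro powr_kernel_integral_has_derivative[OF x s \<delta>(1) _ _ _ \<delta>(2)]
        set_integrable_kernel causal_space_set_integrable_diff x set_integrable_singular_kernel) auto
  have "((\<lambda>z. f x * ((z - a) powr (1 - s) / (1 - s))) has_real_derivative
      f x * (x - a) powr (- s)) (at x)"
    using s x by (auto intro!: derivative_eq_intros)
  from DERIV_cmult[OF DERIV_add[OF I this], of "1 / Gamma (1 - s)"]
  show ?thesis
  proof (rule has_field_derivative_transform_within_open[where S = "{a<..}"])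
    fix z assume "z \<in> {a<..}"
    then show "1 / Gamma (1 - s) * (?I z + f x * ((z - a) powr (1 - s) / (1 - s)))
        = frac_int a (1 - s) f z"
      using frac_int_eq[of "1 - s" z] s by simp
  qed (use x in auto)
qed

lemma frac_deriv_tendsto: "((\<lambda>s. frac_deriv a s f x) \<longlongrightarrow> f x) (at_right 0)"
proof -
  let ?S = "\<lambda>s. LBINT y:{a<..<x}. (x - y) powr (- s - 1) * (f y - f x)"
  \<comment> \<open>The bound is applied at \<open>p = - s\<close>. Any lower limit strictly between
    -1 and 0 would do; with \<open>- 1 / 2\<close> it covers \<open>s < 1 / 2\<close>.\<close>
  obtain M where M: "\<And>p. - 1 / 2 \<le> p \<Longrightarrow> p \<le> 1 \<Longrightarrow>
      \<bar>LBINT y:{a<..<x}. (x - y) powr (p - 1) * (f y - f x)\<bar> \<le> M"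
    using singular_kernel_integral_bounded[of "- 1 / 2"] by auto
  have "eventually (\<lambda>s. \<bar>?S s\<bar> \<le> M) (at_right 0)"
    by (rule eventually_at_rightI[of 0 "1 / 2"]) (auto intro: M)
  then have "((\<lambda>s. s * ?S s) \<longlongrightarrow> 0) (at_right 0)"
    by (rule mult_bounded_tendsto_0)
  moreover have "((\<lambda>s. f x * (x - a) powr (- s)) \<longlongrightarrow> f x * (x - a) powr (- 0)) (at_right 0)"
    using x by (intro tendsto_intros) auto
  ultimately have "((\<lambda>s. 1 / Gamma (1 - s) * (- (s * ?S s) + f x * (x - a) powr (- s))) \<longlongrightarrow>
      1 * (- 0 + f x * (x - a) powr (- 0))) (at_right 0)"
    by (intro tendsto_mult[OF Gamma_reciprocal_tendsto(2)] tendsto_add tendsto_minus)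
  then have "((\<lambda>s. 1 / Gamma (1 - s) * (- (s * ?S s) + f x * (x - a) powr (- s))) \<longlongrightarrow> f x) (at_right 0)"
    using x by simp
  moreover have "eventually (\<lambda>s. 1 / Gamma (1 - s) * (- (s * ?S s) + f x * (x - a) powr (- s))
      = frac_deriv a s f x) (at_right 0)"
    by (rule eventually_at_rightI[of 0 1])
       (auto simp: frac_deriv_def DERIV_imp_deriv[OF frac_int_has_derivative])
  ultimately show ?thesis by (rule Lim_transform_eventually)
qed

end

theorem theorem3:
  fixes a :: real
  shows
    "(\<forall>f\<in>causal_space a. \<forall>x>a.
        (\<forall>s. 0 < s \<and> s \<le> 1 \<longrightarrow> set_integrable lborel {a<..<x} (frac_integrand s f x)) \<and>
        (\<forall>s. 0 < s \<and> s < 1 \<longrightarrow> frac_int a (1 - s) f differentiable at x) \<and>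
        ((\<lambda>s. frac_int a s f x) \<longlongrightarrow> f x) (at_right 0) \<and>
        ((\<lambda>s. frac_deriv a s f x) \<longlongrightarrow> f x) (at_right 0)) \<and>
     op_tendsto a (frac_int a) (frac_int a 0) (at_right 0) \<and>
     (\<forall>f\<in>causal_space a. frac_int a 0 f = id f) \<and>
     op_tendsto a (frac_deriv a) (frac_deriv a 0) (at_right 0) \<and>
     (\<forall>f\<in>causal_space a. frac_deriv a 0 f = id f)"
proof -
  have "(\<forall>s. 0 < s \<and> s \<le> 1 \<longrightarrow> set_integrable lborel {a<..<x} (frac_integrand s f x)) \<and>
        (\<forall>s. 0 < s \<and> s < 1 \<longrightarrow> frac_int a (1 - s) f differentiable at x) \<and>
        ((\<lambda>s. frac_int a s f x) \<longlongrightarrow> f x) (at_right 0) \<and>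
        ((\<lambda>s. frac_deriv a s f x) \<longlongrightarrow> f x) (at_right 0)"
    if f: "f \<in> causal_space a" and x: "a < x" for f x
  proof -
    have "f differentiable at x"
      using f x by (auto simp: causal_space_def)
    \<comment> \<open>These constants depend on \<open>f\<close> and \<open>x\<close> and discharge
      the local assumptions under which the preceding facts were derived.\<close>
    from differentiable_imp_locally_lipschitz_at[OF this] obtain C \<delta> where \<delta>: "0 < \<delta>" "\<And>y. \<bar>y - x\<bar> < \<delta> \<Longrightarrow> \<bar>f y - f x\<bar> \<le> C * \<bar>y - x\<bar>"
      by blast
    note facts = f x \<delta>
    show ?thesis
      using set_integrable_frac_integrand[OF facts] frac_int_has_derivative[OF facts]
        frac_int_tendsto[OF facts] frac_deriv_tendsto[OF facts]
      by (auto simp: real_differentiable_def)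
  qed
  then show ?thesis
    by (auto simp: op_tendsto_def frac_int_def[of a 0] frac_deriv_def[of a 0] fun_eq_iff)
qed

end
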